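(* The random variables $$S_n=\int_{\mathbb{X}}\mathbf{1}_{\xi_n(\mathbf{x})>T}\,P_{\mathbf{X}}(d\mathbf{x})\quad\text{and}\quad R_n=\int_{\mathbb{X}}\mathbf{1}_{p_n(\mathbf{x})>U}\,P_{\mathbf{X}}(d\mathbf{x})$$ satisfy $S_n\leq_{cx}R_n$, i.e. $\mathbb{E}[\varphi(S_n)]\leq\mathbb{E}[\varphi(R_n)]$ for every convex function $\varphi:\mathbb{R}\to\mathbb{R}$ for which the expectations exist.
   Context: Let $d\geq 1$, let $\mathbb{X}\subset\mathbb{R}^d$ be measurable, let $P_{\mathbf{X}}$ be a probability distribution on $\mathbb{X}$, and let $T\in\mathbb{R}$. Let $\xi_n=(\xi_n(\mathbf{x}))_{\mathbf{x}\in\mathbb{X}}$ be a real-valued random process indexed by $\mathbb{X}$, jointly measurable in $(\omega,\mathbf{x})$. (In the paper, $\xi_n$ has the finite-dimensional laws of a prior process $\xi$, typically Gaussian, conditioned on its observed values at $n$ design points $\mathbf{x}_1,\dots,\mathbf{x}_n$; the results are stated to be valid for any prior distribution of the process.) For $\mathbf{x}\in\mathbb{X}$ put $p_n(\mathbf{x})=\mathbb{P}(\xi_n(\mathbf{x})>T)$. Let $U$ be a random variable uniformly distributed on $[0,1]$. Convex order: for real random variables $X,Y$, one writes $X\leq_{cx}Y$ if $\mathbb{E}[\varphi(X)]\leq\mathbb{E}[\varphi(Y)]$ for every convex $\varphi:\mathbb{R}\to\mathbb{R}$, provided the expectations exist. *)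

theory Defs
  imports "HOL-Probability.Probability"
begin

text \<open>
  The two random variables may live on different probability spaces, since only their laws
  matter. Convex functions on the whole real line are continuous, hence \<open>\<phi> \<circ> X\<close> is measurable
  and integrability expresses exactly that the (finite) expectation exists; the guard is needed
  because a Bochner integral is 0 for a non-integrable function.
\<close>

definition convex_order_le :: "'a measure \<Rightarrow> ('a \<Rightarrow> real) \<Rightarrow> 'b measure \<Rightarrow> ('b \<Rightarrow> real) \<Rightarrow> bool"
  where "convex_order_le M X N Y \<longleftrightarrow>
    X \<in> borel_measurable M \<and> Y \<in> borel_measurable N \<and>
    (\<forall>\<phi>::real \<Rightarrow> real. convex_on UNIV \<phi> \<longrightarrow>
        integrable M (\<lambda>\<omega>. \<phi> (X \<omega>)) \<longrightarrow> integrable N (\<lambda>\<omega>. \<phi> (Y \<omega>)) \<longrightarrow>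
        (\<integral>\<omega>. \<phi> (X \<omega>) \<partial>M) \<le> (\<integral>\<omega>. \<phi> (Y \<omega>) \<partial>N))"

definition exceedance_prob :: "'w measure \<Rightarrow> ('x \<Rightarrow> 'w \<Rightarrow> real) \<Rightarrow> real \<Rightarrow> 'x \<Rightarrow> real"
  where "exceedance_prob M \<xi> T x = measure M {\<omega> \<in> space M. \<xi> x \<omega> > T}"

end

theory Submission
  imports Defs
begin

text \<open>
  \<open>S\<close> is the \<open>P\<close>-measure of the random set \<open>{x. \<xi> x \<omega> > T}\<close>, and \<open>R\<close> is the measure of the nested
  random set \<open>{x. p x > U}\<close>, which contains each point \<open>x\<close> with the same probability \<open>p x\<close>.
  Nestedness makes the measure as variable as possible: the events that distinct points belong to
  the set are all of the form \<open>U < c\<close>, so they overlap as much as their probabilities permit.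

  To make this precise, compare the stop-loss transforms \<open>E (S - k)\<^sup>+ \<le> E (R - k)\<^sup>+\<close>. Let \<open>A\<close> be the
  event \<open>S > k\<close> and \<open>a\<close> its probability. By Fubini,
  \<open>E (S - k)\<^sup>+ = E (S 1\<^sub>A) - k a = (\<integral>x. Pr (\<xi> x > T and A) \<partial>P) - k a \<le> (\<integral>x. min (p x) a \<partial>P) - k a\<close>.
  The event \<open>B\<close> given by \<open>U < a\<close> also has probability \<open>a\<close>, and \<open>U < p x\<close> and \<open>B\<close> hold together with
  probability exactly \<open>min (p x) a\<close>. So Fubini on the other side turns the bound into
  \<open>E ((R - k) 1\<^sub>B)\<close>, which is at most \<open>E (R - k)\<^sup>+\<close>. The means agree, both being \<open>\<integral>x. p x \<partial>P\<close>. This is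
  \<open>convex_order_le_monotone_random_set\<close>.

  Equal means and ordered stop-loss transforms give the convex order for variables in the unit
  interval (\<open>convex_order_le_if_stop_loss_le\<close>): a convex function is continuous, hence on the unit
  interval a uniform limit of its piecewise linear interpolants, and each interpolant is an affine
  function plus a combination of functions \<open>s \<mapsto> (s - k)\<^sup>+\<close> whose coefficients, the increments of
  the chord slopes, are nonnegative.
\<close>

section \<open>Piecewise linear interpolation of convex functions\<close>

definition chord_slope :: "(real \<Rightarrow> real) \<Rightarrow> nat \<Rightarrow> nat \<Rightarrow> real"
  where "chord_slope \<phi> n i = real n * (\<phi> (real (Suc i) / real n) - \<phi> (real i / real n))"

text \<open>
  On the unit interval this is the linear interpolant of \<open>\<phi>\<close> at the nodes \<open>i / n\<close>. The \<open>i\<close>-th bracket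
  is the length of the part of the \<open>i\<close>-th grid cell that lies to the left of \<open>s\<close>; it is written as a
  difference of two hinge functions, so that the expectation of the interpolant at a random point
  involves its law only through stop-loss transforms.
\<close>
definition chord_interpolant :: "(real \<Rightarrow> real) \<Rightarrow> nat \<Rightarrow> real \<Rightarrow> real"
  where "chord_interpolant \<phi> n s = \<phi> 0 + (\<Sum>i<n. chord_slope \<phi> n i *
    (max (s - real i / real n) 0 - max (s - real (Suc i) / real n) 0))"

text \<open>This is midpoint convexity: the middle one of three adjacent nodes is their average.\<close>
lemma chord_slope_mono:
  assumes "convex_on UNIV \<phi>" and "n > 0"
  shows "chord_slope \<phi> n i \<le> chord_slope \<phi> n (Suc i)"
proof -
  have mid: "(1 - 1/2) *\<^sub>R (real i / n) + (1/2) *\<^sub>R (real (Suc (Suc i)) / n) = real (Suc i) / n"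
    by (simp add: add_divide_distrib)
  have "\<phi> (real (Suc i) / n) \<le> (1 - 1/2) * \<phi> (real i / n) + 1/2 * \<phi> (real (Suc (Suc i)) / n)"
    using convex_onD[OF assms(1), of "1/2" "real i / n" "real (Suc (Suc i)) / n"] unfolding mid by simp
  moreover have "b - a \<le> c - b" if "b \<le> (1 - 1/2) * a + 1/2 * c" for a b c :: real
    using that by simp
  ultimately have "\<phi> (real (Suc i) / n) - \<phi> (real i / n)
      \<le> \<phi> (real (Suc (Suc i)) / n) - \<phi> (real (Suc i) / n)"
    by blast
  then show ?thesis unfolding chord_slope_def by (intro mult_left_mono) auto
qed

lemma grid_cell_exists:
  fixes s :: real
  assumes "0 \<le> s" "s \<le> 1" "n > 0"
  obtains j where "j < n" "real j / n \<le> s" "s \<le> real (Suc j) / n"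
proof (cases "s = 1")
  case True
  \<comment> \<open>The right end point belongs to the last cell, where rounding \<open>n * s\<close> down would give \<open>n\<close>.\<close>
  have "n - 1 < n" "real (n - 1) / n \<le> s" "s \<le> real (Suc (n - 1)) / n"
    using True assms(3) by auto
  then show ?thesis using that by blast
next
  case False
  define j where "j = nat \<lfloor>n * s\<rfloor>"
  have "0 \<le> n * s" "n * s < n" using assms False by auto
  then have "real j \<le> n * s" "n * s < real (Suc j)" "j < n"
    unfolding j_def by linarith+
  then show ?thesis using assms(3) by (intro that[of j]) (auto simp: field_simps)
qed

text \<open>
  Cells to the left of \<open>s\<close> contribute their full increment of \<open>\<phi>\<close>, which telescopes to
  \<open>\<phi> (j / n) - \<phi> 0\<close>; cells to the right contribute nothing, and the cell of \<open>s\<close> itself contributes the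
  fraction \<open>t\<close> of its increment.
\<close>
lemma chord_interpolant_on_cell:
  assumes "j < n" "real j / n \<le> s" "s \<le> real (Suc j) / n"
  defines "t \<equiv> n * s - j"
  shows "chord_interpolant \<phi> n s = (1 - t) * \<phi> (real j / n) + t * \<phi> (real (Suc j) / n)"
proof -
  have n: "real n > 0" using assms(1) by simp
  let ?f = "\<lambda>i. chord_slope \<phi> n i *
    (max (s - real i / real n) 0 - max (s - real (Suc i) / real n) 0)"
  have below: "?f i = \<phi> (real (Suc i) / n) - \<phi> (real i / n)" if "i < j" for i
  proof -
    have "real (Suc i) / n \<le> real j / n" using that n by (intro divide_right_mono) auto
    moreover have "real i / n \<le> real (Suc i) / n" by (intro divide_right_mono) auto
    ultimately have "real i / n \<le> s" "real (Suc i) / n \<le> s"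
      using assms(2) by linarith+
    then have "max (s - real i / n) 0 - max (s - real (Suc i) / n) 0 = 1 / n"
      by (simp add: max_absorb1 add_divide_distrib)
    then show ?thesis using n by (simp add: chord_slope_def)
  qed
  have above: "?f i = 0" if "i \<in> {Suc j..<n}" for i
  proof -
    have "real (Suc j) / n \<le> real i / n" using that n by (intro divide_right_mono) auto
    moreover have "real i / n \<le> real (Suc i) / n" by (intro divide_right_mono) auto
    ultimately show ?thesis using assms(3) by simp
  qed
  have "(\<Sum>i<n. ?f i) = (\<Sum>i<Suc j. ?f i) + (\<Sum>i=Suc j..<n. ?f i)"
    using assms(1) by (intro sum.atLeastLessThan_concat[of 0 "Suc j" n, symmetric, unfolded atLeast0LessThan]) auto
  also have "(\<Sum>i=Suc j..<n. ?f i) = 0" using above by (intro sum.neutral) blast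
  also have "(\<Sum>i<Suc j. ?f i) = (\<Sum>i<j. \<phi> (real (Suc i) / n) - \<phi> (real i / n)) + ?f j"
    using below by simp
  also have "(\<Sum>i<j. \<phi> (real (Suc i) / n) - \<phi> (real i / n)) = \<phi> (real j / n) - \<phi> 0"
    by (simp only: sum_lessThan_telescope[of "\<lambda>i. \<phi> (real i / n)"]) simp
  also have "?f j = t * (\<phi> (real (Suc j) / n) - \<phi> (real j / n))"
    using assms(2,3) n by (simp add: chord_slope_def t_def field_simps)
  finally show ?thesis unfolding chord_interpolant_def by (simp add: algebra_simps)
qed

text \<open>
  The interpolant at \<open>s\<close> is a convex combination of the values of \<open>\<phi>\<close> at the two ends of a cell that
  contains \<open>s\<close>, so its error is bounded by the oscillation of \<open>\<phi>\<close> over distances at most \<open>1 / n\<close>.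
\<close>
lemma chord_interpolant_uniform_approximation:
  fixes \<phi> :: "real \<Rightarrow> real"
  assumes "continuous_on {0..1} \<phi>" and "e > 0"
  obtains n where "n > 0" "\<And>s. s \<in> {0..1} \<Longrightarrow> \<bar>chord_interpolant \<phi> n s - \<phi> s\<bar> \<le> e"
proof -
  have "uniformly_continuous_on {0..1} \<phi>"
    using assms(1) by (rule compact_uniformly_continuous) simp
  then obtain d where d: "d > 0"
    "\<And>s u. s \<in> {0..1} \<Longrightarrow> u \<in> {0..1} \<Longrightarrow> \<bar>u - s\<bar> < d \<Longrightarrow> \<bar>\<phi> u - \<phi> s\<bar> < e"
    using assms(2) unfolding uniformly_continuous_on_def dist_real_def by metis
  obtain m where m: "inverse (real (Suc m)) < d" using reals_Archimedean[OF d(1)] by blast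
  define n where "n = Suc m"
  have n: "n > 0" "1 / real n < d" using m by (auto simp: n_def inverse_eq_divide)
  show ?thesis
  proof (rule that[OF n(1)])
    fix s :: real assume s: "s \<in> {0..1}"
    then obtain j where j: "j < n" "real j / n \<le> s" "s \<le> real (Suc j) / n"
      using grid_cell_exists[of s n] n(1) by auto
    define t where "t = n * s - j"
    have t: "0 \<le> t" "t \<le> 1" using j n(1) by (auto simp: t_def field_simps)
    have w: "real (Suc j) / n - real j / n = 1 / n" by (simp add: add_divide_distrib)
    have g: "real j / n \<in> {0..1}" "real (Suc j) / n \<in> {0..1}" using j(1) by auto
    have "\<bar>\<phi> (real j / n) - \<phi> s\<bar> < e" using s g j w n by (intro d(2)) auto
    moreover have "\<bar>\<phi> (real (Suc j) / n) - \<phi> s\<bar> < e" using s g j w n by (intro d(2)) auto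
    moreover have "chord_interpolant \<phi> n s - \<phi> s =
        (1 - t) * (\<phi> (real j / n) - \<phi> s) + t * (\<phi> (real (Suc j) / n) - \<phi> s)"
      unfolding chord_interpolant_on_cell[OF j] t_def by (simp add: algebra_simps)
    moreover have "\<bar>(1 - t) * a + t * b\<bar> \<le> e" if "\<bar>a\<bar> < e" "\<bar>b\<bar> < e" for a b
    proof -
      have "\<bar>(1 - t) * a + t * b\<bar> \<le> (1 - t) * \<bar>a\<bar> + t * \<bar>b\<bar>"
        using abs_triangle_ineq[of "(1 - t) * a" "t * b"] t by (simp add: abs_mult)
      also have "\<dots> \<le> e" using that t by (intro convex_bound_le) auto
      finally show ?thesis .
    qed
    ultimately show "\<bar>chord_interpolant \<phi> n s - \<phi> s\<bar> \<le> e" by simp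
  qed
qed

section \<open>From the stop-loss order to the convex order\<close>

text \<open>
  Summation by parts turns the sum into \<open>\<Sum>i=1..<n. (c i - c (i - 1)) * D i\<close> because both boundary
  values of \<open>D\<close> vanish. When \<open>c\<close> lists the slopes of a convex piecewise linear function,
  the increments of \<open>c\<close> are the weights of its hinges.
\<close>
lemma Abel_sum_nonneg:
  fixes c D :: "nat \<Rightarrow> real"
  assumes "\<And>i. c i \<le> c (Suc i)" "\<And>i. D i \<ge> 0" "D 0 = 0" "D n = 0"
  shows "0 \<le> (\<Sum>i<n. c i * (D i - D (Suc i)))"
proof -
  \<comment> \<open>Before the right boundary value is known to vanish, the partial sums carry this boundary term.\<close>
  have "- (c m * D (Suc m)) \<le> (\<Sum>i<Suc m. c i * (D i - D (Suc i)))" for m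
  proof (induction m)
    case 0
    then show ?case using assms(3) by simp
  next
    case (Suc m)
    have "c m * D (Suc m) \<le> c (Suc m) * D (Suc m)" using assms by (intro mult_right_mono) auto
    then show ?case using Suc by (simp add: algebra_simps)
  qed
  from this[of "n - 1"] show ?thesis using assms(4) by (cases n) auto
qed

lemma (in prob_space) integrable_unit_interval:
  fixes X :: "'a \<Rightarrow> real"
  assumes "X \<in> borel_measurable M" "\<And>\<omega>. \<omega> \<in> space M \<Longrightarrow> X \<omega> \<in> {0..1}"
  shows "integrable M X"
  using assms by (intro integrable_const_bound[where B = 1]) (auto intro!: AE_I2)

lemma (in prob_space) expectation_chord_interpolant:
  fixes X :: "'a \<Rightarrow> real"
  assumes "integrable M X"
  shows "integrable M (\<lambda>\<omega>. chord_interpolant \<phi> n (X \<omega>))"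
    and "expectation (\<lambda>\<omega>. chord_interpolant \<phi> n (X \<omega>)) = \<phi> 0 + (\<Sum>i<n. chord_slope \<phi> n i *
      (expectation (\<lambda>\<omega>. max (X \<omega> - real i / n) 0)
        - expectation (\<lambda>\<omega>. max (X \<omega> - real (Suc i) / n) 0)))"
proof -
  have int: "integrable M (\<lambda>\<omega>. max (X \<omega> - k) 0)" for k using assms by simp
  show "integrable M (\<lambda>\<omega>. chord_interpolant \<phi> n (X \<omega>))"
    unfolding chord_interpolant_def using int
    by (intro Bochner_Integration.integrable_add Bochner_Integration.integrable_sum
        integrable_mult_right Bochner_Integration.integrable_diff) auto
  show "expectation (\<lambda>\<omega>. chord_interpolant \<phi> n (X \<omega>)) = \<phi> 0 + (\<Sum>i<n. chord_slope \<phi> n i *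
      (expectation (\<lambda>\<omega>. max (X \<omega> - real i / n) 0)
        - expectation (\<lambda>\<omega>. max (X \<omega> - real (Suc i) / n) 0)))"
    unfolding chord_interpolant_def using int
    by (subst Bochner_Integration.integral_add)
      (auto simp: prob_space Bochner_Integration.integral_sum Bochner_Integration.integral_diff
        simp del: of_nat_Suc)
qed

text \<open>
  For the interpolants the inequality is summation by parts applied to the stop-loss differences
  \<open>D i\<close> at the nodes. These vanish at node \<open>0\<close> because the means agree, and at node \<open>n\<close> because neither
  variable exceeds \<open>1\<close>. Uniform approximation carries it over to \<open>\<phi>\<close>.
\<close>
lemma convex_order_le_if_stop_loss_le:
  fixes X :: "'a \<Rightarrow> real" and Y :: "'b \<Rightarrow> real"
  assumes "prob_space M" "prob_space N"
    and X: "X \<in> borel_measurable M" "\<And>\<omega>. \<omega> \<in> space M \<Longrightarrow> X \<omega> \<in> {0..1}"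
    and Y: "Y \<in> borel_measurable N" "\<And>\<nu>. \<nu> \<in> space N \<Longrightarrow> Y \<nu> \<in> {0..1}"
    and mean: "(\<integral>\<omega>. X \<omega> \<partial>M) = (\<integral>\<nu>. Y \<nu> \<partial>N)"
    and stop_loss: "\<And>k. (\<integral>\<omega>. max (X \<omega> - k) 0 \<partial>M) \<le> (\<integral>\<nu>. max (Y \<nu> - k) 0 \<partial>N)"
  shows "convex_order_le M X N Y"
  unfolding convex_order_le_def
proof (intro conjI allI impI X(1) Y(1))
  interpret M: prob_space M by fact
  interpret N: prob_space N by fact
  note intX = M.integrable_unit_interval[OF X] and intY = N.integrable_unit_interval[OF Y]
  fix \<phi> :: "real \<Rightarrow> real"
  assume convex: "convex_on UNIV \<phi>" and int\<phi>: "integrable M (\<lambda>\<omega>. \<phi> (X \<omega>))" "integrable N (\<lambda>\<nu>. \<phi> (Y \<nu>))"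
  have cont: "continuous_on {0..1} \<phi>"
    using convex_on_continuous[OF open_UNIV convex] continuous_on_subset by blast
  show "(\<integral>\<omega>. \<phi> (X \<omega>) \<partial>M) \<le> (\<integral>\<nu>. \<phi> (Y \<nu>) \<partial>N)"
  proof (rule field_le_epsilon)
    fix e :: real assume "e > 0"
    then obtain n where n: "n > 0"
      "\<And>s. s \<in> {0..1} \<Longrightarrow> \<bar>chord_interpolant \<phi> n s - \<phi> s\<bar> \<le> e / 2"
      using chord_interpolant_uniform_approximation[OF cont, of "e / 2"] by auto
    have n_le: "\<phi> s \<le> chord_interpolant \<phi> n s + e / 2" "chord_interpolant \<phi> n s \<le> \<phi> s + e / 2"
      if "s \<in> {0..1}" for s
      using n(2)[OF that] by linarith+
    define D where "D i = (\<integral>\<nu>. max (Y \<nu> - real i / n) 0 \<partial>N) - (\<integral>\<omega>. max (X \<omega> - real i / n) 0 \<partial>M)"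
      for i
    have "(\<integral>\<nu>. max (Y \<nu>) 0 \<partial>N) = (\<integral>\<nu>. Y \<nu> \<partial>N)" "(\<integral>\<omega>. max (X \<omega>) 0 \<partial>M) = (\<integral>\<omega>. X \<omega> \<partial>M)"
      using X(2) Y(2) by (auto intro!: Bochner_Integration.integral_cong)
    then have D0: "D 0 = 0" unfolding D_def using mean by simp
    have "(\<integral>\<nu>. max (Y \<nu> - 1) 0 \<partial>N) = 0" "(\<integral>\<omega>. max (X \<omega> - 1) 0 \<partial>M) = 0"
      using X(2) Y(2) by (auto intro!: integral_eq_zero_AE AE_I2 simp: max_absorb2)
    then have Dn: "D n = 0" unfolding D_def using n(1) by simp
    have "0 \<le> (\<Sum>i<n. chord_slope \<phi> n i * (D i - D (Suc i)))"
      using chord_slope_mono[OF convex n(1)] stop_loss D0 Dn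
      by (intro Abel_sum_nonneg) (auto simp: D_def)
    also have "\<dots> = (\<integral>\<nu>. chord_interpolant \<phi> n (Y \<nu>) \<partial>N) - (\<integral>\<omega>. chord_interpolant \<phi> n (X \<omega>) \<partial>M)"
      by (simp only: M.expectation_chord_interpolant(2)[OF intX, of \<phi> n]
          N.expectation_chord_interpolant(2)[OF intY, of \<phi> n] D_def add_diff_add sum_subtractf[symmetric])
        (simp add: algebra_simps)
    finally have mid: "(\<integral>\<omega>. chord_interpolant \<phi> n (X \<omega>) \<partial>M) \<le> (\<integral>\<nu>. chord_interpolant \<phi> n (Y \<nu>) \<partial>N)"
      by simp
    have "(\<integral>\<omega>. \<phi> (X \<omega>) \<partial>M) \<le> (\<integral>\<omega>. chord_interpolant \<phi> n (X \<omega>) + e / 2 \<partial>M)"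
      using M.expectation_chord_interpolant(1)[OF intX] int\<phi> n_le(1)[OF X(2)]
      by (intro integral_mono) auto
    also have "\<dots> = (\<integral>\<omega>. chord_interpolant \<phi> n (X \<omega>) \<partial>M) + e / 2"
      using M.expectation_chord_interpolant(1)[OF intX] by (simp add: M.prob_space)
    finally have left: "(\<integral>\<omega>. \<phi> (X \<omega>) \<partial>M) \<le> (\<integral>\<omega>. chord_interpolant \<phi> n (X \<omega>) \<partial>M) + e / 2" .
    have "(\<integral>\<nu>. chord_interpolant \<phi> n (Y \<nu>) \<partial>N) \<le> (\<integral>\<nu>. \<phi> (Y \<nu>) + e / 2 \<partial>N)"
      using N.expectation_chord_interpolant(1)[OF intY] int\<phi> n_le(2)[OF Y(2)]
      by (intro integral_mono) auto
    also have "\<dots> = (\<integral>\<nu>. \<phi> (Y \<nu>) \<partial>N) + e / 2"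
      using int\<phi> by (simp add: N.prob_space)
    finally show "(\<integral>\<omega>. \<phi> (X \<omega>) \<partial>M) \<le> (\<integral>\<nu>. \<phi> (Y \<nu>) \<partial>N) + e" using left mid by linarith
  qed
qed

section \<open>Random sets and their coverage function\<close>

text \<open>
  Write \<open>G \<omega> x\<close> for membership of \<open>x\<close> in a random set. The last statement is Fubini (Robbins' formula
  localised to an event): it reduces expectations of the measure of the random set to the
  probabilities that single points are covered, for which the coverage function gives bounds.
\<close>
lemma
  fixes G :: "'w \<Rightarrow> 'x \<Rightarrow> bool"
  assumes "prob_space M" "prob_space P"
    and [measurable]: "Measurable.pred (M \<Otimes>\<^sub>M P) (\<lambda>(\<omega>, x). G \<omega> x)"
  shows measurable_random_set_measure:
      "(\<lambda>\<omega>. \<integral>x. indicat_real {x. G \<omega> x} x \<partial>P) \<in> borel_measurable M"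
    and random_set_measure_bounds: "(\<integral>x. indicat_real {x. G \<omega> x} x \<partial>P) \<in> {0..1}"
    and measurable_coverage_function: 
      "A \<in> sets M \<Longrightarrow> (\<lambda>x. measure M {\<omega> \<in> space M. G \<omega> x \<and> \<omega> \<in> A}) \<in> borel_measurable P"
    and random_set_measure_on_event:
      "A \<in> sets M \<Longrightarrow> (\<integral>\<omega>. indicat_real A \<omega> * (\<integral>x. indicat_real {x. G \<omega> x} x \<partial>P) \<partial>M)
        = (\<integral>x. measure M {\<omega> \<in> space M. G \<omega> x \<and> \<omega> \<in> A} \<partial>P)"
proof -
  interpret M: prob_space M by fact
  interpret P: prob_space P by fact
  interpret PM: pair_prob_space M P ..
  have ind: "(\<lambda>x. indicat_real {x. G \<omega> x} x) = (\<lambda>x. if G \<omega> x then 1 else 0)" for \<omega>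
    by (auto simp: indicator_def)
  show meas: "(\<lambda>\<omega>. \<integral>x. indicat_real {x. G \<omega> x} x \<partial>P) \<in> borel_measurable M"
    unfolding ind by measurable
  show "(\<integral>x. indicat_real {x. G \<omega> x} x \<partial>P) \<in> {0..1}"
  \<comment> \<open>For \<open>\<omega>\<close> outside the space the section need not be measurable; the integral is then \<open>0\<close>.\<close>
  proof (cases "integrable P (\<lambda>x. indicat_real {x. G \<omega> x} x)")
    case True
    then have "(\<integral>x. indicat_real {x. G \<omega> x} x \<partial>P) \<le> (\<integral>x. 1 \<partial>P)"
      by (intro integral_mono) (auto simp: indicator_def)
    then show ?thesis by (auto simp: P.prob_space)
  qed (simp add: not_integrable_integral_eq)
  assume [measurable]: "A \<in> sets M"
  have prob: "measure M {\<omega> \<in> space M. G \<omega> x \<and> \<omega> \<in> A}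
      = (\<integral>\<omega>. (if G \<omega> x \<and> \<omega> \<in> A then 1 else 0) \<partial>M)" if "x \<in> space P" for x
  proof -
    have "(\<integral>\<omega>. (if G \<omega> x \<and> \<omega> \<in> A then 1 else 0::real) \<partial>M)
        = (\<integral>\<omega>. indicator {\<omega> \<in> space M. G \<omega> x \<and> \<omega> \<in> A} \<omega> \<partial>M)"
      by (intro Bochner_Integration.integral_cong) (auto simp: indicator_def)
    also have "\<dots> = measure M {\<omega> \<in> space M. G \<omega> x \<and> \<omega> \<in> A}"
      using that by (auto intro!: arg_cong[where f = "measure M"])
    finally show ?thesis by simp
  qed
  have "(\<lambda>x. \<integral>\<omega>. (if G \<omega> x \<and> \<omega> \<in> A then 1 else 0::real) \<partial>M) \<in> borel_measurable P"
    by measurable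
  then show "(\<lambda>x. measure M {\<omega> \<in> space M. G \<omega> x \<and> \<omega> \<in> A}) \<in> borel_measurable P"
    by (subst measurable_cong[OF prob])
  have "(\<integral>\<omega>. indicat_real A \<omega> * (\<integral>x. indicat_real {x. G \<omega> x} x \<partial>P) \<partial>M)
      = (\<integral>\<omega>. \<integral>x. (if G \<omega> x \<and> \<omega> \<in> A then 1 else 0) \<partial>P \<partial>M)"
    unfolding ind by (intro Bochner_Integration.integral_cong) (auto simp: indicator_def cong: if_cong)
  also have "\<dots> = (\<integral>x. \<integral>\<omega>. (if G \<omega> x \<and> \<omega> \<in> A then 1 else 0) \<partial>M \<partial>P)"
    by (intro PM.Fubini_integral[symmetric] PM.P.integrable_const_bound[where B = 1]) auto
  also have "\<dots> = (\<integral>x. measure M {\<omega> \<in> space M. G \<omega> x \<and> \<omega> \<in> A} \<partial>P)"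
    by (intro Bochner_Integration.integral_cong) (auto simp: prob)
  finally show "(\<integral>\<omega>. indicat_real A \<omega> * (\<integral>x. indicat_real {x. G \<omega> x} x \<partial>P) \<partial>M)
        = (\<integral>x. measure M {\<omega> \<in> space M. G \<omega> x \<and> \<omega> \<in> A} \<partial>P)" .
qed

lemma uniform_distr_prob_less:
  assumes "U \<in> borel_measurable N" "distr N borel U = uniform_measure lborel {0..1::real}"
    and "0 \<le> c" "c \<le> 1"
  shows "measure N {\<nu> \<in> space N. U \<nu> < c} = c"
proof -
  have "measure N {\<nu> \<in> space N. U \<nu> < c} = measure (distr N borel U) {..<c}"
    using assms(1) by (subst measure_distr) (auto intro!: arg_cong[where f = "measure N"])
  also have "\<dots> = measure lborel ({0..1} \<inter> {..<c})"
    unfolding assms(2) by (subst measure_uniform_measure) auto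
  also have "{0..1} \<inter> {..<c} = {0..<c}" using assms(4) by auto
  also have "measure lborel {0..<c} = c" using assms(3) by simp
  finally show ?thesis .
qed

text \<open>
  A point is covered by the random set while an event of probability \<open>a\<close> occurs with probability at
  most \<open>min (p x) a\<close>, and for the nested set with the event \<open>U < a\<close> this bound is attained at every
  point simultaneously.
\<close>
lemma convex_order_le_monotone_random_set:
  fixes G :: "'w \<Rightarrow> 'x \<Rightarrow> bool" and U :: "'v \<Rightarrow> real"
  assumes "prob_space M" "prob_space P" "prob_space N"
    and G[measurable]: "Measurable.pred (M \<Otimes>\<^sub>M P) (\<lambda>(\<omega>, x). G \<omega> x)"
    and U[measurable]: "U \<in> borel_measurable N"
    and unif: "distr N borel U = uniform_measure lborel {0..1}"
  defines "p \<equiv> \<lambda>x. measure M {\<omega> \<in> space M. G \<omega> x}"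
  shows "convex_order_le M (\<lambda>\<omega>. \<integral>x. indicat_real {x. G \<omega> x} x \<partial>P)
    N (\<lambda>\<nu>. \<integral>x. indicat_real {x. p x > U \<nu>} x \<partial>P)"
    (is "convex_order_le M ?S N ?R")
proof -
  interpret M: prob_space M by fact
  interpret P: prob_space P by fact
  interpret N: prob_space N by fact
  note S = measurable_random_set_measure[OF assms(1,2) G] random_set_measure_bounds[OF assms(1,2) G]
  have p[measurable]: "p \<in> borel_measurable P"
    using measurable_coverage_function[OF assms(1,2) G sets.top] 
    by (simp add: p_def conj_commute cong: conj_cong)
  have H: "Measurable.pred (N \<Otimes>\<^sub>M P) (\<lambda>(\<nu>, x). p x > U \<nu>)" by measurable
  note R = measurable_random_set_measure[OF assms(3,2) H] random_set_measure_bounds[OF assms(3,2) H]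
  note intS = M.integrable_unit_interval[OF S] and intR = N.integrable_unit_interval[OF R]
  have p01: "0 \<le> p x" "p x \<le> 1" for x by (auto simp: p_def)
  \<comment> \<open>For the nested set, a point is covered jointly with \<open>U < a\<close> exactly when \<open>U < min (p x) a\<close>.
      This is the largest possible joint probability, and the reason why the nested set is extremal.\<close>
  have R_event: "(\<integral>\<nu>. indicat_real {\<nu> \<in> space N. U \<nu> < a} \<nu> * ?R \<nu> \<partial>N) = (\<integral>x. min (p x) a \<partial>P)"
    if "0 \<le> a" "a \<le> 1" for a
  proof -
    have "measure N {\<nu> \<in> space N. U \<nu> < p x \<and> \<nu> \<in> {\<nu> \<in> space N. U \<nu> < a}} = min (p x) a" for x
    proof -
      have "{\<nu> \<in> space N. U \<nu> < p x \<and> \<nu> \<in> {\<nu> \<in> space N. U \<nu> < a}} = {\<nu> \<in> space N. U \<nu> < min (p x) a}"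
        by auto
      then show ?thesis using uniform_distr_prob_less[OF U unif, of "min (p x) a"] that p01[of x] by simp
    qed
    then show ?thesis by (subst random_set_measure_on_event[OF assms(3,2) H]) auto
  qed
  show ?thesis
  proof (rule convex_order_le_if_stop_loss_le[OF assms(1,3) S R])
    have "(\<integral>\<omega>. ?S \<omega> \<partial>M) = (\<integral>\<omega>. indicat_real (space M) \<omega> * ?S \<omega> \<partial>M)"
      by (intro Bochner_Integration.integral_cong) auto
    also have "\<dots> = (\<integral>x. p x \<partial>P)"
      by (subst random_set_measure_on_event[OF assms(1,2) G sets.top])
        (simp add: p_def conj_commute cong: conj_cong)
    \<comment> \<open>The formula for nested sets applies with \<open>a = 1\<close>, as the set is empty when \<open>U\<close> is at least \<open>1\<close>.\<close>
    also have "\<dots> = (\<integral>x. min (p x) 1 \<partial>P)" using p01 by (simp add: min_absorb1)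
    also have "\<dots> = (\<integral>\<nu>. indicat_real {\<nu> \<in> space N. U \<nu> < 1} \<nu> * ?R \<nu> \<partial>N)"
      by (rule R_event[symmetric]) auto
    also have "\<dots> = (\<integral>\<nu>. ?R \<nu> \<partial>N)"
    proof (intro Bochner_Integration.integral_cong refl)
      fix \<nu> assume "\<nu> \<in> space N"
      moreover have "{x. p x > U \<nu>} = {}" if "1 \<le> U \<nu>"
        using that p01(2) by (auto simp: not_less intro: order_trans)
      ultimately show "indicat_real {\<nu> \<in> space N. U \<nu> < 1} \<nu> * ?R \<nu> = ?R \<nu>"
        by (cases "U \<nu> < 1") (auto simp: indicator_def)
    qed
    finally show "(\<integral>\<omega>. ?S \<omega> \<partial>M) = (\<integral>\<nu>. ?R \<nu> \<partial>N)" .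
  next
    fix k :: real
    \<comment> \<open>\<open>B\<close> plays for \<open>R\<close> the role that \<open>A\<close> plays for \<open>S\<close>: an event of the same probability, on which the
        comparison with \<open>(R - k)\<^sup>+\<close> is an inequality instead of an equality.\<close>
    define A where "A = {\<omega> \<in> space M. ?S \<omega> > k}"
    define a where "a = measure M A"
    define B where "B = {\<nu> \<in> space N. U \<nu> < a}"
    have A[measurable]: "A \<in> sets M" unfolding A_def using S(1) by measurable
    have B[measurable]: "B \<in> sets N" unfolding B_def by measurable
    have a01: "0 \<le> a" "a \<le> 1" by (auto simp: a_def)
    have B_prob: "measure N B = a" unfolding B_def by (rule uniform_distr_prob_less[OF U unif a01])
    have intA: "integrable M (\<lambda>\<omega>. indicat_real A \<omega> * ?S \<omega>)"
      using integrable_mult_indicator[OF A intS] by simp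
    have intB: "integrable N (\<lambda>\<nu>. indicat_real B \<nu> * ?R \<nu>)"
      using integrable_mult_indicator[OF B intR] by simp
    have "integrable N (indicat_real B)" by (simp add: N.emeasure_eq_measure)
    then have intRB: "integrable N (\<lambda>\<nu>. indicat_real B \<nu> * ?R \<nu> - k * indicat_real B \<nu>)"
      using intB by (intro Bochner_Integration.integrable_diff integrable_mult_right)
    have "(\<integral>\<omega>. max (?S \<omega> - k) 0 \<partial>M) = (\<integral>\<omega>. indicat_real A \<omega> * ?S \<omega> - k * indicat_real A \<omega> \<partial>M)"
      by (intro Bochner_Integration.integral_cong) (auto simp: A_def indicator_def)
    also have "\<dots> = (\<integral>\<omega>. indicat_real A \<omega> * ?S \<omega> \<partial>M) - k * a"
      using intA by (simp add: a_def M.emeasure_eq_measure)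
    also have "(\<integral>\<omega>. indicat_real A \<omega> * ?S \<omega> \<partial>M) = (\<integral>x. measure M {\<omega> \<in> space M. G \<omega> x \<and> \<omega> \<in> A} \<partial>P)"
      by (rule random_set_measure_on_event[OF assms(1,2) G A])
    also have "\<dots> \<le> (\<integral>x. min (p x) a \<partial>P)"
    proof (rule integral_mono)
      show "integrable P (\<lambda>x. measure M {\<omega> \<in> space M. G \<omega> x \<and> \<omega> \<in> A})"
        using measurable_coverage_function[OF assms(1,2) G A]
        by (intro P.integrable_unit_interval) auto
      show "integrable P (\<lambda>x. min (p x) a)"
        using p01 a01 by (intro P.integrable_unit_interval) (auto simp: min_le_iff_disj)
      fix x assume [measurable]: "x \<in> space P"
      show "measure M {\<omega> \<in> space M. G \<omega> x \<and> \<omega> \<in> A} \<le> min (p x) a"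
        unfolding p_def a_def by (intro min.boundedI M.finite_measure_mono) auto
    qed
    also have "(\<integral>x. min (p x) a \<partial>P) = (\<integral>\<nu>. indicat_real B \<nu> * ?R \<nu> \<partial>N)"
      unfolding B_def by (rule R_event[OF a01, symmetric])
    also have "\<dots> - k * a = (\<integral>\<nu>. indicat_real B \<nu> * ?R \<nu> - k * indicat_real B \<nu> \<partial>N)"
      using intB by (simp add: B_prob N.emeasure_eq_measure)
    also have "\<dots> \<le> (\<integral>\<nu>. max (?R \<nu> - k) 0 \<partial>N)"
      using intR by (intro integral_mono intRB) (auto simp: indicator_def)
    finally show "(\<integral>\<omega>. max (?S \<omega> - k) 0 \<partial>M) \<le> (\<integral>\<nu>. max (?R \<nu> - k) 0 \<partial>N)" by simp
  qed
qed

theorem proposition4p1: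
  fixes XX :: "(real ^ 'd) set"
    and PX :: "(real ^ 'd) measure"
    and T :: real
    and M :: "'w measure"
    and \<xi> :: "real ^ 'd \<Rightarrow> 'w \<Rightarrow> real"
    and N :: "'v measure"
    and U :: "'v \<Rightarrow> real"
  assumes "XX \<in> sets borel"
    and "prob_space PX" and "sets PX = sets (restrict_space borel XX)"
    and "prob_space M"
    and "(\<lambda>(\<omega>, x). \<xi> x \<omega>) \<in> borel_measurable (M \<Otimes>\<^sub>M restrict_space borel XX)"
    and "prob_space N" and "U \<in> borel_measurable N"
    and "distr N borel U = uniform_measure lborel {0..1}"
  shows "convex_order_le
    M (\<lambda>\<omega>. \<integral>x. indicat_real {x. \<xi> x \<omega> > T} x \<partial>PX)
    N (\<lambda>\<nu>. \<integral>x. indicat_real {x. exceedance_prob M \<xi> T x > U \<nu>} x \<partial>PX)"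
proof -
  \<comment> \<open>Measurability is given for the trace of the Borel sets, which is the \<open>\<sigma>\<close>-algebra of \<open>PX\<close>.\<close>
  have "sets (M \<Otimes>\<^sub>M PX) = sets (M \<Otimes>\<^sub>M restrict_space borel XX)"
    by (intro sets_pair_measure_cong refl assms(3))
  then have [measurable]: "(\<lambda>(\<omega>, x). \<xi> x \<omega>) \<in> borel_measurable (M \<Otimes>\<^sub>M PX)"
    using assms(5) measurable_cong_sets by blast
  have "Measurable.pred (M \<Otimes>\<^sub>M PX) (\<lambda>(\<omega>, x). \<xi> x \<omega> > T)" by measurable
  from convex_order_le_monotone_random_set[OF assms(4,2,6) this assms(7,8)]
  show ?thesis unfolding exceedance_prob_def .
qed

end
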